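(* Let $M=(V,E,F)$ be a simply connected discrete surface with dual $M^*=(V^*,E^*,F^* )$. (A) Let $z:V\to\mathbb{R}^2\cong\mathbb{C}$ be a non-degenerate realization of $M$ and $q:E_{int}\to\mathbb{R}$ a discrete holomorphic quadratic differential with respect to $z$. Then there exists $\mathcal{F}:V^*\to\mathbb{C}^3$ such that for every edge $\{ij\}\in E_{int}$ $$d\mathcal{F}(e^*_{ij})=\frac{q_{ij}}{z_j-z_i}\begin{pmatrix}1-z_iz_j\\ i(1+z_iz_j)\\ z_i+z_j\end{pmatrix}. \qquad ( * )$$ Assume moreover that the inverse stereographic projection $$N:=\frac{1}{1+|z|^2}\begin{pmatrix}2\operatorname{Re}z\\2\operatorname{Im}z\\|z|^2-1\end{pmatrix}:V\to\mathbb{S}^2$$ of $z$ is admissible, i.e. $N_i\neq -N_j$ for $\{ij\}\in E$. Then (1) $f:=\operatorname{Re}(\mathcal{F}):V^*\to\mathbb{R}^3$ is A-minimal, and (2) $\tilde f:=\operatorname{Re}(i\mathcal{F}):V^*\to\mathbb{R}^3$ is C-minimal. The realizations $(f,\tilde f)$ form a conjugate pair of minimal surfaces with Gauss map $N$. (B) The converse also holds: for every conjugate pair of minimal surfaces $(f,\tilde f)$ there exists a discrete holomorphic quadratic differential $q$ on the stereographic projection $z$ of their Gauss map such that $\mathcal{F}:=f-i\tilde f$ satisfies $( * )$. (In the vector in $( * )$ and in $i\mathcal{F}$, $f-i\tilde f$, the symbol $i$ as a coefficient is the imaginary unit; as a subscript it is a vertex.)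
   Context: A discrete surface is a cell decomposition $M=(V,E,F)$ of an oriented surface, with or without boundary; $V_{int}$ and $E_{int}$ denote the interior vertices and interior edges. $M^*=(V^*,E^*,F^* )$ is the dual cell decomposition: elements of $V^*$ correspond to faces of $M$, and each $i\in V$ corresponds to a dual face $i^*\in F^*$. $e_{ij}$ is the oriented edge from $i$ to $j$; for an interior edge, $e_{ij}^*$ is the dual edge oriented from the right face $\phi_r$ of $e_{ij}$ to its left face $\phi_l$. For $N$ defined on $V$, $dN(e_{ij})=N_j-N_i$; for $f$ defined on $V^*$, $df(e^*_{ij})=f_{\phi_l}-f_{\phi_r}$. Sums $\sum_j$ run over the neighbors $j$ of $i$. A realization is an assignment of positions to vertices; it is non-degenerate if the endpoints of every edge have distinct positions. A realization $N:V\to\mathbb{S}^2\subset\mathbb{R}^3$ is admissible if $N_i\neq -N_j$ for every edge $\{ij\}$. The stereographic projection of $N=(N_1,N_2,N_3)$ (components) is $z=\frac{N_1}{1-N_3}+i\frac{N_2}{1-N_3}$. Given a non-degenerate realization $z:V\to\mathbb{C}$, a function $q:E_{int}\to\mathbb{R}$ is a discrete holomorphic quadratic differential with respect to (or on) $z$ if for every $i\in V_{int}$: $\sum_j q_{ij}=0$ and $\sum_j q_{ij}/(z_j-z_i)=0$. A realization $f:V^*\to\mathbb{R}^3$ is A-minimal with Gauss map $N:V\to\mathbb{S}^2$ if $N$ is admissible and for every interior edge $\{ij\}$: $dN(e_{ij})\times df(e^*_{ij})=0$ and $\langle N_i+N_j, df(e^*_{ij})\rangle=0$. A realization $\tilde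 f:V^*\to\mathbb{R}^3$ is C-minimal with Gauss map $N:V\to\mathbb{S}^2$ if $N$ is admissible, $\tilde f$ has planar faces with face normal $N$ (so $N_i$ and $N_j$ are both orthogonal to $d\tilde f(e^*_{ij})$ for every interior edge $\{ij\}$), and the scalar mean curvature $\tilde H_i:=\sum_j |d\tilde f(e^*_{ij})|\tan\frac{\alpha_{ij}}{2}$ vanishes for every $i\in V_{int}$. Here, if $d\tilde f(e^*_{ij})\ne0$, the dihedral angle $\alpha_{ij}\in(-\pi,\pi)$ is determined by $\sin\alpha_{ij}=\langle N_i\times N_j, d\tilde f(e^*_{ij})/|d\tilde f(e^*_{ij})|\rangle$ and $\cos\alpha_{ij}=\langle N_i,N_j\rangle$; if $d\tilde f(e^*_{ij})=0$ the term is $0$. A conjugate pair of minimal surfaces with Gauss map $N$ is a pair $(f,\tilde f)$ with $f$ A-minimal and $\tilde f$ C-minimal, both with Gauss map $N$, such that $d\tilde f(e^*_{ij})=N_i\times df(e^*_{ij})=N_j\times df(e^*_{ij})$ for every interior edge $\{ij\}$.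
   Formalization: In (B) it is additionally assumed that no N_i is the north pole (0,0,1), so that z is defined, and that z is non-degenerate (z_i ≠ z_j on every edge); without this z or q is undefined, e.g. for constant N. *)

theory Defs
  imports "HOL-Analysis.Analysis" "HOL-Combinatorics.Orbits"
begin

text \<open>
  A cell decomposition of an oriented surface is encoded by its oriented edges: every edge occurs
  with both orientations \<open>e\<close> and \<open>opp M e\<close>.  \<open>lface M e\<close> is the face to the left of \<open>e\<close>, or
  \<open>None\<close> if there is only boundary to the left.  If there is a face to the left, \<open>nxt M e\<close> is the
  oriented edge that follows \<open>e\<close> when that face is traversed counterclockwise.
  Multiple edges between the same two vertices are allowed, and the surface may be infinite.
\<close>

record ('v, 'e, 'f) cell_decomp =
  verts :: "'v set"
  oedges :: "'e set"
  faces :: "'f set"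
  src :: "'e \<Rightarrow> 'v"
  opp :: "'e \<Rightarrow> 'e"
  lface :: "'e \<Rightarrow> 'f option"
  nxt :: "'e \<Rightarrow> 'e"

definition tgt :: "('v, 'e, 'f) cell_decomp \<Rightarrow> 'e \<Rightarrow> 'v" where
  "tgt M e = src M (opp M e)"

definition faced_oedges :: "('v, 'e, 'f) cell_decomp \<Rightarrow> 'e set" where
  "faced_oedges M = {e \<in> oedges M. lface M e \<noteq> None}"

definition int_oedges :: "('v, 'e, 'f) cell_decomp \<Rightarrow> 'e set" where
  "int_oedges M = {e \<in> oedges M. lface M e \<noteq> None \<and> lface M (opp M e) \<noteq> None}"

definition edge :: "('v, 'e, 'f) cell_decomp \<Rightarrow> 'e \<Rightarrow> 'e set" where
  "edge M e = {e, opp M e}"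

definition star :: "('v, 'e, 'f) cell_decomp \<Rightarrow> 'v \<Rightarrow> 'e set" where
  "star M i = {e \<in> oedges M. src M e = i}"

text \<open>A vertex lies on the boundary iff it is an endpoint of some boundary edge.\<close>

definition int_verts :: "('v, 'e, 'f) cell_decomp \<Rightarrow> 'v set" where
  "int_verts M = {i \<in> verts M. star M i \<subseteq> int_oedges M}"

text \<open>
  For \<open>e\<close> with a face on its left, \<open>opp M e\<close> and \<open>nxt M e\<close> are the two oriented edges starting at
  \<open>tgt M e\<close> that bound the corner of this face at \<open>tgt M e\<close>.
\<close>

definition corner :: "('v, 'e, 'f) cell_decomp \<Rightarrow> 'e \<Rightarrow> 'e \<Rightarrow> bool" where
  "corner M a b \<longleftrightarrow> (\<exists>e\<in>faced_oedges M. a = opp M e \<and> b = nxt M e)"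

text \<open>
  The axiom \<open>lface_orbit\<close> says that the faces correspond to the cycles of \<open>nxt\<close>.  As \<open>orbit g e\<close>
  consists of the iterates \<open>(g ^^ n) e\<close> with \<open>n > 0\<close> only, its instance \<open>e' = e\<close> makes every such
  cycle finite.  The axioms \<open>finite_star\<close> and \<open>star_connected\<close> force the corners around a vertex
  to form one finite cycle (interior vertex) or one finite chain (boundary vertex); together with
  the fact that every oriented edge has at most one face on its left, this makes the glued polygons
  an oriented surface with or without boundary.
\<close>

locale discrete_surface =
  fixes M :: "('v, 'e, 'f) cell_decomp"
  assumes opp_in: "e \<in> oedges M \<Longrightarrow> opp M e \<in> oedges M"
    and opp_opp: "e \<in> oedges M \<Longrightarrow> opp M (opp M e) = e"
    and opp_neq: "e \<in> oedges M \<Longrightarrow> opp M e \<noteq> e"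
    and verts_eq: "verts M = src M ` oedges M"
    and faces_eq: "faces M = {\<phi>. \<exists>e\<in>oedges M. lface M e = Some \<phi>}"
    and has_face: "e \<in> oedges M \<Longrightarrow> lface M e \<noteq> None \<or> lface M (opp M e) \<noteq> None"
    and nxt_in: "e \<in> faced_oedges M \<Longrightarrow> nxt M e \<in> faced_oedges M"
    and src_nxt: "e \<in> faced_oedges M \<Longrightarrow> src M (nxt M e) = tgt M e"
    and lface_orbit: "e \<in> faced_oedges M \<Longrightarrow> e' \<in> faced_oedges M \<Longrightarrow>
      lface M e = lface M e' \<longleftrightarrow> e' \<in> orbit (nxt M) e"
    and finite_star: "i \<in> verts M \<Longrightarrow> finite (star M i)"
    and star_connected: "e \<in> star M i \<Longrightarrow> e' \<in> star M i \<Longrightarrow> equivclp (corner M) e e'"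

fun edge_path :: "('v, 'e, 'f) cell_decomp \<Rightarrow> 'v \<Rightarrow> 'e list \<Rightarrow> 'v \<Rightarrow> bool" where
  "edge_path M i [] j \<longleftrightarrow> i \<in> verts M \<and> i = j"
| "edge_path M i (e # p) j \<longleftrightarrow> e \<in> oedges M \<and> src M e = i \<and> edge_path M (tgt M e) p j"

text \<open>The boundary of the face to the left of \<open>e\<close>, traversed once starting with \<open>e\<close>.\<close>

definition face_boundary :: "('v, 'e, 'f) cell_decomp \<Rightarrow> 'e \<Rightarrow> 'e list" where
  "face_boundary M e = map (\<lambda>k. (nxt M ^^ k) e) [0..<card (orbit (nxt M) e)]"

text \<open>
  The elementary moves of the edge-path group of a cell complex: removing a backtracking and
  removing the boundary of a face.
\<close>

inductive homotopy_step :: "('v, 'e, 'f) cell_decomp \<Rightarrow> 'v \<Rightarrow> 'v \<Rightarrow> 'e list \<Rightarrow> 'e list \<Rightarrow> bool"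
  for M i j where
  backtrack: "edge_path M i (p @ [e, opp M e] @ r) j \<Longrightarrow>
    homotopy_step M i j (p @ [e, opp M e] @ r) (p @ r)"
| face: "edge_path M i (p @ face_boundary M e @ r) j \<Longrightarrow> e \<in> faced_oedges M \<Longrightarrow>
    homotopy_step M i j (p @ face_boundary M e @ r) (p @ r)"

definition simply_connected_surface :: "('v, 'e, 'f) cell_decomp \<Rightarrow> bool" where
  "simply_connected_surface M \<longleftrightarrow>
    (\<forall>i\<in>verts M. \<forall>j\<in>verts M. \<exists>p. edge_path M i p j) \<and>
    (\<forall>i\<in>verts M. \<forall>p. edge_path M i p i \<longrightarrow> equivclp (homotopy_step M i i) p [])"

definition primal_diff :: "('v, 'e, 'f) cell_decomp \<Rightarrow> ('v \<Rightarrow> 'a::ab_group_add) \<Rightarrow> 'e \<Rightarrow> 'a" where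
  "primal_diff M N e = N (tgt M e) - N (src M e)"

text \<open>
  The dual edge of an interior oriented edge \<open>e\<close> runs from the right face of \<open>e\<close>, which is the left
  face of \<open>opp M e\<close>, to the left face of \<open>e\<close>.
\<close>

definition dual_diff :: "('v, 'e, 'f) cell_decomp \<Rightarrow> ('f \<Rightarrow> 'a::ab_group_add) \<Rightarrow> 'e \<Rightarrow> 'a" where
  "dual_diff M f e = f (the (lface M e)) - f (the (lface M (opp M e)))"

definition nondegenerate :: "('v, 'e, 'f) cell_decomp \<Rightarrow> ('v \<Rightarrow> 'a) \<Rightarrow> bool" where
  "nondegenerate M z \<longleftrightarrow> (\<forall>e\<in>oedges M. z (src M e) \<noteq> z (tgt M e))"

text \<open>
  Sums over the neighbours \<open>j\<close> of \<open>i\<close> are taken over the oriented edges starting at \<open>i\<close>, so that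
  multiple edges are counted separately.
\<close>

definition hol_quad_diff ::
  "('v, 'e, 'f) cell_decomp \<Rightarrow> ('v \<Rightarrow> complex) \<Rightarrow> ('e set \<Rightarrow> real) \<Rightarrow> bool" where
  "hol_quad_diff M z q \<longleftrightarrow> (\<forall>i\<in>int_verts M.
    (\<Sum>e\<in>star M i. q (edge M e)) = 0 \<and>
    (\<Sum>e\<in>star M i. complex_of_real (q (edge M e)) / (z (tgt M e) - z i)) = 0)"

definition inv_stereo :: "complex \<Rightarrow> real^3" where
  "inv_stereo z = (1 / (1 + (cmod z)\<^sup>2)) *\<^sub>R vector [2 * Re z, 2 * Im z, (cmod z)\<^sup>2 - 1]"

definition stereo :: "real^3 \<Rightarrow> complex" where
  "stereo n = Complex (n $ 1 / (1 - n $ 3)) (n $ 2 / (1 - n $ 3))"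

definition admissible :: "('v, 'e, 'f) cell_decomp \<Rightarrow> ('v \<Rightarrow> real^3) \<Rightarrow> bool" where
  "admissible M N \<longleftrightarrow>
    (\<forall>i\<in>verts M. norm (N i) = 1) \<and> (\<forall>e\<in>oedges M. N (src M e) \<noteq> - N (tgt M e))"

definition A_minimal ::
  "('v, 'e, 'f) cell_decomp \<Rightarrow> ('v \<Rightarrow> real^3) \<Rightarrow> ('f \<Rightarrow> real^3) \<Rightarrow> bool" where
  "A_minimal M N f \<longleftrightarrow> admissible M N \<and> (\<forall>e\<in>int_oedges M.
    cross3 (primal_diff M N e) (dual_diff M f e) = 0 \<and>
    (N (src M e) + N (tgt M e)) \<bullet> dual_diff M f e = 0)"

definition dihedral_angle ::
  "('v, 'e, 'f) cell_decomp \<Rightarrow> ('v \<Rightarrow> real^3) \<Rightarrow> ('f \<Rightarrow> real^3) \<Rightarrow> 'e \<Rightarrow> real" where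
  "dihedral_angle M N f e = (THE \<alpha>. - pi < \<alpha> \<and> \<alpha> < pi \<and>
    sin \<alpha> = cross3 (N (src M e)) (N (tgt M e)) \<bullet>
      ((1 / norm (dual_diff M f e)) *\<^sub>R dual_diff M f e) \<and>
    cos \<alpha> = N (src M e) \<bullet> N (tgt M e))"

definition mean_curvature ::
  "('v, 'e, 'f) cell_decomp \<Rightarrow> ('v \<Rightarrow> real^3) \<Rightarrow> ('f \<Rightarrow> real^3) \<Rightarrow> 'v \<Rightarrow> real" where
  "mean_curvature M N f i = (\<Sum>e\<in>star M i.
    if dual_diff M f e = 0 then 0
    else norm (dual_diff M f e) * tan (dihedral_angle M N f e / 2))"

definition C_minimal ::
  "('v, 'e, 'f) cell_decomp \<Rightarrow> ('v \<Rightarrow> real^3) \<Rightarrow> ('f \<Rightarrow> real^3) \<Rightarrow> bool" where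
  "C_minimal M N f \<longleftrightarrow> admissible M N \<and>
    (\<forall>e\<in>int_oedges M. N (src M e) \<bullet> dual_diff M f e = 0 \<and> N (tgt M e) \<bullet> dual_diff M f e = 0) \<and>
    (\<forall>i\<in>int_verts M. mean_curvature M N f i = 0)"

definition conjugate_pair ::
  "('v, 'e, 'f) cell_decomp \<Rightarrow> ('v \<Rightarrow> real^3) \<Rightarrow> ('f \<Rightarrow> real^3) \<Rightarrow> ('f \<Rightarrow> real^3) \<Rightarrow> bool" where
  "conjugate_pair M N f f' \<longleftrightarrow> A_minimal M N f \<and> C_minimal M N f' \<and>
    (\<forall>e\<in>int_oedges M.
      dual_diff M f' e = cross3 (N (src M e)) (dual_diff M f e) \<and>
      dual_diff M f' e = cross3 (N (tgt M e)) (dual_diff M f e))"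

definition Re_vec :: "complex^3 \<Rightarrow> real^3" where
  "Re_vec w = (\<chi> k. Re (w $ k))"

definition complex_vec :: "real^3 \<Rightarrow> complex^3" where
  "complex_vec x = (\<chi> k. complex_of_real (x $ k))"

definition weierstrass_rep ::
  "('v, 'e, 'f) cell_decomp \<Rightarrow> ('v \<Rightarrow> complex) \<Rightarrow> ('e set \<Rightarrow> real) \<Rightarrow> ('f \<Rightarrow> complex^3) \<Rightarrow> bool" where
  "weierstrass_rep M z q \<F> \<longleftrightarrow> (\<forall>e\<in>int_oedges M.
    dual_diff M \<F> e =
      (complex_of_real (q (edge M e)) / (z (tgt M e) - z (src M e))) *s
        vector [1 - z (src M e) * z (tgt M e),
                \<i> * (1 + z (src M e) * z (tgt M e)),
                z (src M e) + z (tgt M e)])"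

end

theory Submission
  imports Defs
begin

text \<open>
  Two facts carry the theorem, one about a single edge and one about the whole surface.

  On an edge with endpoints \<open>z\<close>, \<open>w\<close> and inverse stereographic projections \<open>n\<close>, \<open>m\<close>, the vector
  \<open>W\<close> in the representation formula satisfies \<open>Re W = k (m - n)\<close> and \<open>Re (\<i> W) = k n \<times> m\<close> with
  \<open>k = 2 q / \<bar>m - n\<bar>\<^sup>2\<close> (\<open>Re_weierstrass_vec\<close>).  The edge conditions of A-minimality, of face normals
  and of conjugacy can be read off from these two formulas.  The half-angle formula
  \<open>tan (\<alpha>/2) = sin \<alpha> / (1 + cos \<alpha>)\<close> turns the contribution of the edge to the scalar mean
  curvature into \<open>k \<bar>m - n\<bar>\<^sup>2 / 2 = q\<close> (\<open>norm_mult_tan_dihedral\<close>).  Hence the scalar mean curvature at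
  \<open>i\<close> is \<open>\<Sum>\<^sub>j q\<^sub>i\<^sub>j\<close>, the first of the two sums that define holomorphic quadratic differentials.

  The second sum is about closedness.  Since
  \<open>W = q / (w - z) (1 - z\<^sup>2, \<i> (1 + z\<^sup>2), 2 z) + q (- z, \<i> z, 1)\<close>, the sum of \<open>W\<close> around an
  interior vertex vanishes if both sums do; conversely, if \<open>W\<close> is the difference of a function on the
  faces, it sums to zero around the vertex, and this with \<open>\<Sum>\<^sub>j q\<^sub>i\<^sub>j = 0\<close> gives
  \<open>\<Sum>\<^sub>j q\<^sub>i\<^sub>j / (z\<^sub>j - z\<^sub>i) = 0\<close>.

  What is left is to integrate: on a simply connected surface, a form on the dual edges that sums to
  zero around interior vertices is exact (\<open>closed_dual_form_exact\<close>).  Simple connectivity speaks of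
  paths in the primal graph, whereas the form lives on the dual graph.  The two are linked through
  the corners of the faces.  Around one vertex the form has a primitive \<open>g\<close> on the corners; it is
  unique up to a constant that depends on the vertex.  From a corner of a face to the next one, along
  an edge, \<open>g\<close> jumps by an amount that is the same for the two faces adjacent to this edge.  So the
  jumps are a primal form, which by construction sums to zero around every face.  Its primitive \<open>h\<close> on
  the vertices is exactly the choice of constants that makes \<open>g - h\<close> a function of the face alone.
\<close>

section \<open>Iterating a map until it reaches a target\<close>

lemma finite_inj_returns:
  assumes "finite S" "inj_on f S" "f ` S \<subseteq> S" "a \<in> S"
  shows "\<exists>n. (f ^^ Suc n) a = a"
proof -
  have in_S: "(f ^^ n) a \<in> S" for n
    using assms(3,4) by (induction n) auto
  then have "\<not> inj (\<lambda>n. (f ^^ n) a)"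
    using assms(1) by (metis finite_imageD finite_subset image_subsetI infinite_UNIV_nat)
  then obtain m n where "(f ^^ m) a = (f ^^ n) a" "m < n"
    unfolding inj_def by (metis linorder_neqE_nat)
  then obtain k where "(f ^^ m) a = (f ^^ (m + Suc k)) a"
    by (metis less_iff_Suc_add add_Suc_right)
  then show ?thesis
  proof (induction m)
    case 0
    then have "(f ^^ Suc k) a = a" by simp
    then show ?case by blast
  next
    case (Suc m)
    then have "f ((f ^^ m) a) = f ((f ^^ (m + Suc k)) a)" by simp
    then have "(f ^^ m) a = (f ^^ (m + Suc k)) a"
      using assms(2) in_S by (metis inj_onD)
    with Suc show ?case by blast
  qed
qed

text \<open>
  Sum \<open>\<omega>\<close> along the iterates of \<open>f\<close> until the first visit to \<open>t\<close>.  Stopping at \<open>t\<close> makes the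
  construction indifferent to whether \<open>f\<close> returns from \<open>t\<close> (a cycle) or is meaningless there (the end
  of a chain).
\<close>

lemma primitive_along_iteration:
  fixes \<omega> :: "'e \<Rightarrow> 'a::ab_group_add"
  assumes "\<And>a. a \<in> S \<Longrightarrow> \<exists>n. (f ^^ n) a = t"
  shows "\<exists>g. \<forall>a\<in>S. a \<noteq> t \<longrightarrow> g a - g (f a) = \<omega> a"
proof (intro exI ballI impI)
  define dist where "dist a = (LEAST n. (f ^^ n) a = t)" for a
  define g where "g a = (\<Sum>m<dist a. \<omega> ((f ^^ m) a))" for a
  fix a assume "a \<in> S" "a \<noteq> t"
  then obtain n where "(f ^^ n) a = t" using assms by blast
  then have "dist a = Suc (dist (f a))"
    unfolding dist_def using \<open>a \<noteq> t\<close>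
    by (subst Least_Suc[of _ n]) (auto simp: funpow_swap1)
  then show "g a - g (f a) = \<omega> a"
    by (simp add: g_def sum.lessThan_Suc_shift funpow_swap1 del: sum.lessThan_Suc)
qed

section \<open>Rotation around a vertex\<close>

text \<open>
  The clockwise rotation around the source of an edge: \<open>rot M e\<close> is the next edge of the star if
  there is a face to the right of \<open>e\<close>, and arbitrary otherwise.
\<close>

definition rot :: "('v, 'e, 'f) cell_decomp \<Rightarrow> 'e \<Rightarrow> 'e" where
  "rot M e = nxt M (opp M e)"

context discrete_surface
begin

lemma int_oedges_iff:
  "e \<in> int_oedges M \<longleftrightarrow> e \<in> faced_oedges M \<and> opp M e \<in> faced_oedges M"
  using opp_in by (auto simp: int_oedges_def faced_oedges_def)

lemma faced_in: "e \<in> faced_oedges M \<Longrightarrow> e \<in> oedges M"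
  by (simp add: faced_oedges_def)

lemma int_in: "e \<in> int_oedges M \<Longrightarrow> e \<in> oedges M"
  by (simp add: int_oedges_def)

lemma opp_int: "e \<in> int_oedges M \<Longrightarrow> opp M e \<in> int_oedges M"
  using opp_opp by (auto simp: int_oedges_iff faced_in)

lemma tgt_opp: "e \<in> oedges M \<Longrightarrow> tgt M (opp M e) = src M e"
  by (simp add: tgt_def opp_opp)

lemma src_opp: "src M (opp M e) = tgt M e"
  by (simp add: tgt_def)

lemma edge_opp: "e \<in> oedges M \<Longrightarrow> edge M (opp M e) = edge M e"
  by (auto simp: edge_def opp_opp)

lemma src_in: "e \<in> oedges M \<Longrightarrow> src M e \<in> verts M"
  by (simp add: verts_eq)

lemma tgt_in: "e \<in> oedges M \<Longrightarrow> tgt M e \<in> verts M"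
  by (simp add: tgt_def src_in opp_in)

lemma faced_or_opp_faced:
  "e \<in> oedges M \<Longrightarrow> e \<in> faced_oedges M \<or> opp M e \<in> faced_oedges M"
  using has_face opp_in by (auto simp: faced_oedges_def)

lemma self_in_orbit: "e \<in> faced_oedges M \<Longrightarrow> e \<in> orbit (nxt M) e"
  using lface_orbit by blast

lemma lface_nxt: "e \<in> faced_oedges M \<Longrightarrow> lface M (nxt M e) = lface M e"
  using lface_orbit[of e "nxt M e"] nxt_in orbit.base by metis

text \<open>
  The axioms only give that \<open>nxt\<close> has finite cycles.  It permutes each of them, and two edges with the
  same successor lie in the same cycle.
\<close>

lemma inj_on_nxt: "inj_on (nxt M) (faced_oedges M)"
proof (rule inj_onI)
  fix e e' assume e: "e \<in> faced_oedges M" "e' \<in> faced_oedges M" "nxt M e = nxt M e'"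
  let ?O = "orbit (nxt M) e"
  have "finite ?O"
    using self_in_orbit[OF e(1)] by (rule finite_orbit)
  moreover have "nxt M ` ?O = ?O"
    using self_in_orbit[OF e(1)] by (auto elim: orbit.cases intro: orbit.intros)
  ultimately have "inj_on (nxt M) ?O" by (simp add: eq_card_imp_inj_on)
  moreover have "e' \<in> ?O"
    using e lface_nxt lface_orbit by metis
  ultimately show "e = e'"
    using e(3) self_in_orbit[OF e(1)] by (auto dest: inj_onD)
qed

lemma rot_faced: "opp M e \<in> faced_oedges M \<Longrightarrow> rot M e \<in> faced_oedges M"
  by (simp add: rot_def nxt_in)

lemma rot_star:
  "a \<in> star M i \<Longrightarrow> opp M a \<in> faced_oedges M \<Longrightarrow> rot M a \<in> star M i"
  using rot_faced[of a] by (auto simp: star_def rot_def src_nxt tgt_opp faced_in)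

lemma lface_rot: "opp M e \<in> faced_oedges M \<Longrightarrow> lface M (rot M e) = lface M (opp M e)"
  by (simp add: rot_def lface_nxt)

lemma corner_iff:
  "a \<in> oedges M \<Longrightarrow> corner M a b \<longleftrightarrow> opp M a \<in> faced_oedges M \<and> b = rot M a"
  by (auto simp: corner_def rot_def opp_opp faced_in intro: bexI[of _ "opp M a"])

lemma bij_betw_rot:
  assumes "i \<in> verts M" "\<forall>a\<in>star M i. opp M a \<in> faced_oedges M"
  shows "bij_betw (rot M) (star M i) (star M i)"
proof -
  have "inj_on (rot M) (star M i)"
  proof (rule inj_onI)
    fix a b assume ab: "a \<in> star M i" "b \<in> star M i" "rot M a = rot M b"
    then have "opp M a = opp M b"
      using assms(2) inj_on_nxt by (auto simp: rot_def dest: inj_onD)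
    with ab show "a = b" by (metis (no_types, lifting) mem_Collect_eq opp_opp star_def)
  qed
  moreover have "rot M ` star M i \<subseteq> star M i"
    using assms(2) rot_star by blast
  ultimately show ?thesis
    using endo_inj_surj[OF finite_star[OF assms(1)]] by (simp add: bij_betw_def)
qed

text \<open>
  A face to the right of every edge suffices: the rotation then permutes the star, and
  every edge in its image has a face on its left.
\<close>

lemma int_verts_iff:
  "i \<in> int_verts M \<longleftrightarrow> i \<in> verts M \<and> (\<forall>a\<in>star M i. opp M a \<in> faced_oedges M)"
proof
  assume "i \<in> verts M \<and> (\<forall>a\<in>star M i. opp M a \<in> faced_oedges M)"
  moreover from this have "rot M ` star M i = star M i"
    using bij_betw_rot by (auto simp: bij_betw_def)
  ultimately show "i \<in> int_verts M"
    using rot_faced by (auto simp: int_verts_def int_oedges_iff) (metis imageE)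
qed (auto simp: int_verts_def int_oedges_iff)

lemma sum_star_rot:
  assumes "i \<in> int_verts M"
  shows "(\<Sum>a\<in>star M i. g (rot M a)) = (\<Sum>a\<in>star M i. g a)"
  using assms by (intro sum.reindex_bij_betw bij_betw_rot) (auto simp: int_verts_iff)

text \<open>
  Rotating \<open>e\<close> brings its right face to the left, so the sum telescopes around the vertex.
\<close>

lemma sum_dual_diff_star:
  assumes "i \<in> int_verts M"
  shows "(\<Sum>e\<in>star M i. dual_diff M F e) = 0"
proof -
  have "dual_diff M F e = F (the (lface M e)) - F (the (lface M (rot M e)))"
    if "e \<in> star M i" for e
    using assms that by (simp add: dual_diff_def lface_rot int_verts_iff)
  then show ?thesis
    using sum_star_rot[OF assms, of "\<lambda>e. F (the (lface M e))"] by (simp add: sum_subtractf)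
qed

text \<open>
  Connectedness of the star through corners is symmetric, so a step may lead forwards or backwards.
  The only critical one is the step forwards out of \<open>t\<close>, after which the rotation must come back.
\<close>

lemma rot_reaches:
  assumes t: "t \<in> star M i" and b: "b \<in> star M i"
    and ret: "opp M t \<in> faced_oedges M \<Longrightarrow> \<exists>n. (rot M ^^ Suc n) t = t"
  shows "\<exists>n. (rot M ^^ n) b = t"
proof -
  have "equivclp (corner M) t b" using star_connected t b .
  then have "b \<in> oedges M \<and> (\<exists>n. (rot M ^^ n) b = t)"
  proof (induction rule: equivclp_induct)
    case base
    have "(rot M ^^ 0) t = t" by simp
    then show ?case using t unfolding star_def by blast
  next
    case (step y z)
    then obtain n where y: "y \<in> oedges M" and n: "(rot M ^^ n) y = t" by blast
    consider "corner M y z" | "corner M z y" using step.hyps(2) by blast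
    then show ?case
    proof cases
      case 1
      then have z: "opp M y \<in> faced_oedges M" "z = rot M y" using y by (auto simp: corner_iff)
      then have "\<exists>m. (rot M ^^ Suc m) y = t"
        using n ret by (cases n) auto
      then show ?thesis using z rot_faced[of y] by (auto simp: funpow_swap1 faced_in)
    next
      case 2
      then obtain e where e: "e \<in> faced_oedges M" "z = opp M e" "y = nxt M e"
        by (auto simp: corner_def)
      then have z: "z \<in> oedges M" "y = rot M z"
        by (auto simp: rot_def faced_in opp_in opp_opp)
      then have "(rot M ^^ Suc n) z = t" using n by (simp add: funpow_swap1)
      then show ?thesis using z by blast
    qed
  qed
  then show ?thesis by blast
qed

text \<open>
  The target of the rotation is the last edge of the chain around a boundary vertex, and an
  arbitrary edge \<open>t\<close> at an interior vertex.  In the latter case the equation at \<open>t\<close> itself is still to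
  be shown; it follows from all the others, because both sides sum to zero over the star.
\<close>

lemma star_primitive:
  fixes \<omega> :: "'e \<Rightarrow> 'a::ab_group_add"
  assumes i: "i \<in> verts M"
    and closed: "i \<in> int_verts M \<Longrightarrow> (\<Sum>e\<in>star M i. \<omega> e) = 0"
  shows "\<exists>g. \<forall>a\<in>star M i. opp M a \<in> faced_oedges M \<longrightarrow> g a - g (rot M a) = \<omega> a"
proof (cases "i \<in> int_verts M")
  case False
  then obtain t where t: "t \<in> star M i" "opp M t \<notin> faced_oedges M"
    using i by (auto simp: int_verts_iff)
  then have "\<And>b. b \<in> star M i \<Longrightarrow> \<exists>n. (rot M ^^ n) b = t"
    using rot_reaches by blast
  from primitive_along_iteration[OF this, where S = "star M i" and \<omega> = \<omega>]
  obtain g where "\<forall>a\<in>star M i. a \<noteq> t \<longrightarrow> g a - g (rot M a) = \<omega> a" by blast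
  then show ?thesis using t(2) by metis
next
  case True
  then have bij: "bij_betw (rot M) (star M i) (star M i)"
    by (auto intro: bij_betw_rot simp: int_verts_iff)
  obtain t where t: "t \<in> star M i" using i by (auto simp: star_def verts_eq)
  have "\<exists>n. (rot M ^^ Suc n) t = t"
    using bij i t finite_star by (intro finite_inj_returns[of "star M i"]) (auto simp: bij_betw_def)
  then have "\<And>b. b \<in> star M i \<Longrightarrow> \<exists>n. (rot M ^^ n) b = t"
    using rot_reaches t by blast
  from primitive_along_iteration[OF this, where S = "star M i" and \<omega> = \<omega>]
  obtain g where g: "\<forall>a\<in>star M i. a \<noteq> t \<longrightarrow> g a - g (rot M a) = \<omega> a" by blast
  let ?R = "star M i - {t}"
  have fin: "finite (star M i)" using finite_star i by blast
  have "(\<Sum>a\<in>star M i. g a - g (rot M a)) = (\<Sum>a\<in>star M i. \<omega> a)"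
    using sum_star_rot[OF True, of g] closed[OF True] by (simp add: sum_subtractf)
  then have "g t - g (rot M t) + (\<Sum>a\<in>?R. g a - g (rot M a)) = \<omega> t + (\<Sum>a\<in>?R. \<omega> a)"
    using fin t by (simp add: sum.remove)
  moreover have "(\<Sum>a\<in>?R. g a - g (rot M a)) = (\<Sum>a\<in>?R. \<omega> a)"
    using g by (intro sum.cong) auto
  ultimately have "g t - g (rot M t) = \<omega> t" by simp
  with g show ?thesis by metis
qed

text \<open>
  The edge \<open>a\<close> stands for the corner at its source of the face to its left.  This corner determines the
  vertex, so the primitives around different vertices fit into one function on oriented edges.
\<close>

lemma corner_primitive:
  fixes \<omega> :: "'e \<Rightarrow> 'a::ab_group_add"
  assumes closed: "\<And>i. i \<in> int_verts M \<Longrightarrow> (\<Sum>e\<in>star M i. \<omega> e) = 0"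
  obtains g where "\<And>a. a \<in> int_oedges M \<Longrightarrow> g a - g (rot M a) = \<omega> a"
proof -
  have "\<forall>i\<in>verts M. \<exists>g. \<forall>a\<in>star M i. opp M a \<in> faced_oedges M \<longrightarrow> g a - g (rot M a) = \<omega> a"
    using star_primitive closed by blast
  then obtain G where G: "\<And>i a. i \<in> verts M \<Longrightarrow> a \<in> star M i \<Longrightarrow> opp M a \<in> faced_oedges M \<Longrightarrow>
      G i a - G i (rot M a) = \<omega> a"
    by metis
  show thesis
  proof
    fix a assume a: "a \<in> int_oedges M"
    then have s: "a \<in> star M (src M a)" "opp M a \<in> faced_oedges M"
      by (auto simp: star_def int_in int_oedges_iff)
    then have "src M (rot M a) = src M a" using rot_star by (auto simp: star_def)
    then show "G (src M a) a - G (src M (rot M a)) (rot M a) = \<omega> a"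
      using G s a by (simp add: src_in int_in)
  qed
qed

section \<open>Integrating closed forms\<close>

definition rev_path :: "'e list \<Rightarrow> 'e list" where
  "rev_path p = rev (map (opp M) p)"

lemma edge_path_verts: "edge_path M i p j \<Longrightarrow> i \<in> verts M \<and> j \<in> verts M"
  by (induction p arbitrary: i) (auto simp: src_in)

lemma edge_path_append:
  "edge_path M i (p @ r) j \<longleftrightarrow> (\<exists>k. edge_path M i p k \<and> edge_path M k r j)"
  by (induction p arbitrary: i) (use edge_path_verts in auto)

lemma edge_path_oedges: "edge_path M i p j \<Longrightarrow> set p \<subseteq> oedges M"
  by (induction p arbitrary: i) auto

lemma edge_path_rev: "edge_path M i p j \<Longrightarrow> edge_path M j (rev_path p) i"
proof (induction p arbitrary: i)
  case (Cons e p)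
  then show ?case
    by (auto simp: rev_path_def edge_path_append opp_in src_opp tgt_opp src_in)
qed (simp add: rev_path_def)

lemma closed_form_loop_sum:
  fixes \<eta> :: "'e \<Rightarrow> 'a::ab_group_add"
  assumes sc: "simply_connected_surface M"
    and anti: "\<And>e. e \<in> oedges M \<Longrightarrow> \<eta> (opp M e) = - \<eta> e"
    and face: "\<And>e. e \<in> faced_oedges M \<Longrightarrow> sum_list (map \<eta> (face_boundary M e)) = 0"
    and p: "edge_path M i p i"
  shows "sum_list (map \<eta> p) = 0"
proof -
  have step: "sum_list (map \<eta> p) = sum_list (map \<eta> p')" if "homotopy_step M i i p p'" for p p'
    using that
  proof cases
    case (backtrack p e r)
    have "e \<in> oedges M" using edge_path_oedges[OF backtrack(3)] by simp
    then show ?thesis using backtrack anti by simp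
  next
    case face
    then show ?thesis using assms(3) by simp
  qed
  have "equivclp (homotopy_step M i i) p []"
    using sc p edge_path_verts[OF p] by (auto simp: simply_connected_surface_def)
  then show ?thesis
    by (induction rule: converse_equivclp_induct) (use step in auto)
qed

text \<open>
  The value of the primitive at a vertex is the sum of the form along any path from a fixed base
  vertex.
\<close>

lemma closed_form_exact:
  fixes \<eta> :: "'e \<Rightarrow> 'a::ab_group_add"
  assumes sc: "simply_connected_surface M"
    and anti: "\<And>e. e \<in> oedges M \<Longrightarrow> \<eta> (opp M e) = - \<eta> e"
    and face: "\<And>e. e \<in> faced_oedges M \<Longrightarrow> sum_list (map \<eta> (face_boundary M e)) = 0"
  obtains h where "\<And>e. e \<in> oedges M \<Longrightarrow> primal_diff M h e = \<eta> e"
proof (cases "oedges M = {}")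
  case True
  with that show thesis by simp
next
  case False
  then obtain o' where o: "o' \<in> verts M" by (auto simp: verts_eq)
  define P where "P j = (SOME p. edge_path M o' p j)" for j
  have P: "edge_path M o' (P j) j" if "j \<in> verts M" for j
    unfolding P_def using sc o that by (metis simply_connected_surface_def someI)
  have rev_sum: "sum_list (map \<eta> (rev_path p)) = - sum_list (map \<eta> p)"
    if "set p \<subseteq> oedges M" for p
    using that by (induction p) (auto simp: rev_path_def anti)
  show thesis
  proof
    fix e assume e: "e \<in> oedges M"
    let ?p = "P (src M e) @ [e] @ rev_path (P (tgt M e))"
    have "edge_path M o' ?p o'"
      using e P src_in tgt_in edge_path_rev by (auto simp: edge_path_append)
    then have "sum_list (map \<eta> ?p) = 0"
      using closed_form_loop_sum[OF sc anti face] by blast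
    moreover have "set (P (tgt M e)) \<subseteq> oedges M"
      using P e edge_path_oedges tgt_in by blast
    ultimately show "primal_diff M (\<lambda>j. sum_list (map \<eta> (P j))) e = \<eta> e"
      by (simp add: primal_diff_def rev_sum algebra_simps eq_diff_eq)
  qed
qed

text \<open>
  The sum telescopes, since the boundary of a face is one full cycle of \<open>nxt\<close>.
\<close>

lemma face_boundary_sum:
  fixes g :: "'e \<Rightarrow> 'a::ab_group_add"
  assumes e: "e \<in> faced_oedges M"
    and \<eta>: "\<And>e. e \<in> faced_oedges M \<Longrightarrow> \<eta> e = g (nxt M e) - g e"
  shows "sum_list (map \<eta> (face_boundary M e)) = 0"
proof -
  let ?n = "card (orbit (nxt M) e)"
  note self = self_in_orbit[OF e]
  have in_faced: "(nxt M ^^ k) e \<in> faced_oedges M" for k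
    by (induction k) (auto simp: e nxt_in)
  have "?n = funpow_dist1 (nxt M) e e"
    unfolding orbit_conv_funpow_dist1[OF self]
    using inj_on_funpow_dist1[OF self] by (simp add: card_image del: funpow.simps)
  then have "(nxt M ^^ ?n) e = e" using funpow_dist1_prop[OF self] by simp
  moreover have "sum_list (map \<eta> (map (\<lambda>k. (nxt M ^^ k) e) [0..<n])) = g ((nxt M ^^ n) e) - g e" for n
    by (induction n) (auto simp: \<eta>[OF in_faced])
  ultimately show ?thesis by (simp add: face_boundary_def)
qed

text \<open>
  Triviality of primal loops is used to integrate a form on the dual edges.  The translation goes
  through the primitive \<open>g\<close> on corners, whose jumps along faces form the primal form \<open>\<eta>\<close>.
\<close>

lemma closed_dual_form_exact:
  fixes \<omega> :: "'e \<Rightarrow> 'a::ab_group_add"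
  assumes sc: "simply_connected_surface M"
    and anti: "\<And>e. e \<in> int_oedges M \<Longrightarrow> \<omega> (opp M e) = - \<omega> e"
    and closed: "\<And>i. i \<in> int_verts M \<Longrightarrow> (\<Sum>e\<in>star M i. \<omega> e) = 0"
  shows "\<exists>F. \<forall>e\<in>int_oedges M. dual_diff M F e = \<omega> e"
proof -
  obtain g where g: "\<And>a. a \<in> int_oedges M \<Longrightarrow> g a - g (rot M a) = \<omega> a"
    using corner_primitive[of \<omega>] closed by blast
  \<comment> \<open>Both faces of an interior edge give the same jump; the second case is for edges whose only face
    is on the right.\<close>
  define \<eta> where "\<eta> e = (if e \<in> faced_oedges M then g (nxt M e) - g e
      else g (opp M e) - g (nxt M (opp M e)))" for e
  have \<eta>_anti: "\<eta> (opp M e) = - \<eta> e" if e: "e \<in> oedges M" for e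
  proof (cases "e \<in> int_oedges M")
    case True
    have "g e - g (nxt M (opp M e)) = \<omega> e" "g (opp M e) - g (nxt M e) = - \<omega> e"
      using g[OF True] g[OF opp_int[OF True]] anti[OF True] e by (simp_all add: rot_def opp_opp)
    then have "g e - g (nxt M (opp M e)) = - (g (opp M e) - g (nxt M e))" by simp
    then show ?thesis using True e
      by (simp add: \<eta>_def int_oedges_iff algebra_simps)
  next
    case False
    then show ?thesis using faced_or_opp_faced[OF e] e
      by (auto simp: \<eta>_def int_oedges_iff opp_opp)
  qed
  have "\<And>e. e \<in> faced_oedges M \<Longrightarrow> sum_list (map \<eta> (face_boundary M e)) = 0"
    by (rule face_boundary_sum[where g = g]) (auto simp: \<eta>_def)
  then obtain h where h: "\<And>e. e \<in> oedges M \<Longrightarrow> primal_diff M h e = \<eta> e"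
    using closed_form_exact[OF sc, of \<eta>] \<eta>_anti by blast
  \<comment> \<open>Subtracting the primitive of the jumps makes the corner function constant on each face.\<close>
  define G where "G e = g e - h (src M e)" for e
  have G_nxt: "G (nxt M e) = G e" if "e \<in> faced_oedges M" for e
    using h[of e] that by (simp add: G_def primal_diff_def src_nxt faced_in \<eta>_def algebra_simps)
  have G_orbit: "e' \<in> faced_oedges M \<and> G e' = G e"
    if "e' \<in> orbit (nxt M) e" "e \<in> faced_oedges M" for e e'
    using that by (induction rule: orbit.induct) (auto simp: G_nxt nxt_in)
  \<comment> \<open>Only faces of the surface matter; elsewhere the choice is arbitrary.\<close>
  define F where "F \<phi> = G (SOME e. e \<in> faced_oedges M \<and> lface M e = Some \<phi>)" for \<phi>
  have F: "F (the (lface M e)) = G e" if e: "e \<in> faced_oedges M" for e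
  proof -
    define e' where "e' = (SOME e'. e' \<in> faced_oedges M \<and> lface M e' = Some (the (lface M e)))"
    have l: "lface M e = Some (the (lface M e))" using e by (auto simp: faced_oedges_def)
    have "e' \<in> faced_oedges M \<and> lface M e' = Some (the (lface M e))"
      unfolding e'_def by (rule someI[where x = e]) (use e l in simp)
    then have "e' \<in> orbit (nxt M) e" using e l lface_orbit by metis
    then show ?thesis using G_orbit[of e' e] e by (simp add: F_def flip: e'_def)
  qed
  show ?thesis
  proof (intro exI ballI)
    fix e assume e: "e \<in> int_oedges M"
    then have *: "e \<in> faced_oedges M" "opp M e \<in> faced_oedges M" by (auto simp: int_oedges_iff)
    then have "dual_diff M F e = G e - G (rot M e)"
      by (simp add: dual_diff_def F rot_def G_nxt)
    also have "\<dots> = g e - g (rot M e)"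
      using * by (simp add: G_def rot_def src_nxt tgt_opp faced_in)
    finally show "dual_diff M F e = \<omega> e" using g[OF e] by simp
  qed
qed

end

section \<open>The Weierstrass vector of an edge\<close>

definition weierstrass_vec :: "complex \<Rightarrow> complex \<Rightarrow> real \<Rightarrow> complex^3" where
  "weierstrass_vec z w q = (of_real q / (w - z)) *s vector [1 - z * w, \<i> * (1 + z * w), z + w]"

text \<open>
  The chordal metric of the Riemann sphere.  It converts the factor \<open>q / (w - z)\<close> of the
  representation formula into the edge length of the Gauss map.
\<close>

lemma norm_inv_stereo_diff:
  "(norm (inv_stereo w - inv_stereo z))\<^sup>2 = 4 * (cmod (w - z))\<^sup>2 / ((1 + (cmod z)\<^sup>2) * (1 + (cmod w)\<^sup>2))"
proof -
  obtain a b c d where zw: "z = Complex a b" "w = Complex c d" by (meson complex.exhaust)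
  have "1 + (a\<^sup>2+b\<^sup>2) \<noteq> 0" "1 + (c\<^sup>2+d\<^sup>2) \<noteq> 0" by (auto simp: add_nonneg_eq_0_iff)
  then show ?thesis
    unfolding power2_norm_eq_inner[where 'a = "real^3"] zw
    by (simp add: inner_vec_def sum_3 inv_stereo_def cmod_power2 divide_simps) algebra
qed

text \<open>
  Multiplying numerator and denominator by the conjugate of \<open>w - z\<close>, the first component of the real
  part has numerator \<open>Re ((1 - z w) (cnj w - cnj z)) = Re w (1 + \<bar>z\<bar>\<^sup>2) - Re z (1 + \<bar>w\<bar>\<^sup>2)\<close>, which is
  \<open>(1 + \<bar>z\<bar>\<^sup>2) (1 + \<bar>w\<bar>\<^sup>2) / 2\<close> times the corresponding difference of projections.  The other
  components are similar; for \<open>z = w\<close> both sides are zero by the convention on division.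
\<close>

lemma Re_weierstrass_vec:
  fixes q :: real and z w :: complex
  defines "k \<equiv> 2 * q / (norm (inv_stereo w - inv_stereo z))\<^sup>2"
  shows "Re_vec (weierstrass_vec z w q) = k *\<^sub>R (inv_stereo w - inv_stereo z)"
    and "Re_vec (\<i> *s weierstrass_vec z w q) = k *\<^sub>R cross3 (inv_stereo z) (inv_stereo w)"
proof -
  obtain a b c d where zw: "z = Complex a b" "w = Complex c d" by (meson complex.exhaust)
  define D where "D = (cmod (w - z))\<^sup>2"
  define A where "A = 1 + (cmod z)\<^sup>2"
  define B where "B = 1 + (cmod w)\<^sup>2"
  define r where "r = q / D"
  have k: "k = r * A * B / 2"
    by (simp add: k_def norm_inv_stereo_diff r_def A_def B_def D_def mult_ac)
  have A: "A = 1 + a\<^sup>2 + b\<^sup>2" and B: "B = 1 + c\<^sup>2 + d\<^sup>2"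
    by (simp_all add: A_def B_def zw cmod_power2)
  have nz: "A \<noteq> 0" "B \<noteq> 0" by (auto simp: A_def B_def add_nonneg_eq_0_iff)
  have u: "of_real q / (w - z) = Complex (r * (c - a)) (- (r * (d - b)))"
    by (simp add: complex_eq_iff Re_divide Im_divide zw r_def D_def cmod_power2)
  have A_eq: "(cmod z)\<^sup>2 - 1 = A - 2" "1 + (cmod z)\<^sup>2 = A"
    by (simp_all add: A_def)
  have z: "inv_stereo z = vector [2 * a / A, 2 * b / A, 1 - 2 / A]"
    using nz(1) unfolding inv_stereo_def A_eq vec_eq_iff forall_3
    by (simp add: zw diff_divide_distrib)
  have B_eq: "(cmod w)\<^sup>2 - 1 = B - 2" "1 + (cmod w)\<^sup>2 = B"
    by (simp_all add: B_def)
  have w: "inv_stereo w = vector [2 * c / B, 2 * d / B, 1 - 2 / B]"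
    using nz(2) unfolding inv_stereo_def B_eq vec_eq_iff forall_3
    by (simp add: zw diff_divide_distrib)
  show "Re_vec (weierstrass_vec z w q) = k *\<^sub>R (inv_stereo w - inv_stereo z)"
    unfolding z w k weierstrass_vec_def u using nz
    by (simp add: vec_eq_iff forall_3 Re_vec_def zw field_simps, unfold A B) (intro conjI; algebra)
  show "Re_vec (\<i> *s weierstrass_vec z w q) = k *\<^sub>R cross3 (inv_stereo z) (inv_stereo w)"
    unfolding z w k weierstrass_vec_def u using nz
    by (simp add: vec_eq_iff forall_3 Re_vec_def zw cross3_def field_simps, unfold A B)
      (intro conjI; algebra)
qed

lemma inv_stereo_stereo:
  assumes "norm n = 1" "n $ 3 \<noteq> 1"
  shows "inv_stereo (stereo n) = n"
proof -
  define x y s where "x = n $ 1" and "y = n $ 2" and "s = n $ 3"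
  have "n \<bullet> n = 1" using assms(1) by (simp add: norm_eq_1)
  then have sq: "x\<^sup>2 + y\<^sup>2 = 1 - s\<^sup>2"
    by (simp add: inner_vec_def sum_3 x_def y_def s_def power2_eq_square)
  have s: "1 - s \<noteq> 0" using assms(2) by (simp add: s_def)
  have "(cmod (stereo n))\<^sup>2 = (x\<^sup>2 + y\<^sup>2) / (1 - s)\<^sup>2"
    by (simp add: stereo_def cmod_power2 x_def y_def s_def power_divide add_divide_distrib)
  also have "\<dots> = (1 + s) / (1 - s)"
    unfolding sq using s by (simp add: divide_simps) (simp add: algebra_simps power2_eq_square)
  finally have *: "(cmod (stereo n))\<^sup>2 = (1 + s) / (1 - s)" .
  show ?thesis
    unfolding vec_eq_iff forall_3 inv_stereo_def * using s
    by (simp add: stereo_def flip: x_def y_def s_def) (simp add: field_simps)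
qed

text \<open>
  The unique angle is the principal argument of \<open>c + \<i> s\<close>; \<open>c \<noteq> -1\<close> keeps it away from \<open>pi\<close>.
\<close>

lemma tan_half_angle:
  fixes s c :: real
  assumes "s\<^sup>2 + c\<^sup>2 = 1" "c \<noteq> -1"
  shows "tan ((THE \<alpha>. - pi < \<alpha> \<and> \<alpha> < pi \<and> sin \<alpha> = s \<and> cos \<alpha> = c) / 2) = s / (1 + c)"
proof -
  let ?z = "Complex c s"
  have "cmod ?z = 1" using assms by (simp add: cmod_def add.commute)
  then have A: "?z = cis (Arg ?z)" by (metis cis_Arg norm_zero sgn_div_norm scaleR_one inverse_1 zero_neq_one)
  then have cs: "cos (Arg ?z) = c" "sin (Arg ?z) = s" by (metis cis.sel complex.sel)+
  have r: "- pi < Arg ?z" "Arg ?z \<le> pi" using Arg_bounded by auto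
  have "Arg ?z \<noteq> pi" using cs assms(2) by auto
  with r have r': "Arg ?z < pi" by simp
  have "(THE \<alpha>. - pi < \<alpha> \<and> \<alpha> < pi \<and> sin \<alpha> = s \<and> cos \<alpha> = c) = Arg ?z"
  proof (rule the_equality)
    fix \<alpha> assume "- pi < \<alpha> \<and> \<alpha> < pi \<and> sin \<alpha> = s \<and> cos \<alpha> = c"
    then show "\<alpha> = Arg ?z"
      by (intro cis_Arg_unique[symmetric]) (auto simp: complex_eq_iff sgn_eq \<open>cmod ?z = 1\<close>)
  qed (use r r' cs in auto)
  then show ?thesis using tan_half[of "Arg ?z / 2"] cs by simp
qed

text \<open>
  The contribution of one edge to the mean curvature, with \<open>d\<close> the dual edge vector.  The sine of the
  dihedral angle is \<open>sgn k \<bar>n \<times> m\<bar>\<close>, so that the half-angle formula gives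
  \<open>k \<bar>n \<times> m\<bar>\<^sup>2 / (1 + c) = k (1 - c)\<close> for \<open>c = n \<bullet> m\<close>, and \<open>\<bar>m - n\<bar>\<^sup>2 = 2 (1 - c)\<close>.
  Keeping \<open>k\<close> signed makes the result linear in \<open>k\<close>.
\<close>

lemma norm_mult_tan_dihedral:
  fixes n m :: "real^3"
  assumes n: "norm n = 1" and m: "norm m = 1" and "n \<noteq> m" "n \<noteq> - m"
    and d: "d = k *\<^sub>R cross3 n m"
  shows "(if d = 0 then 0 else norm d * tan ((THE \<alpha>. - pi < \<alpha> \<and> \<alpha> < pi \<and>
      sin \<alpha> = cross3 n m \<bullet> ((1 / norm d) *\<^sub>R d) \<and> cos \<alpha> = n \<bullet> m) / 2))
    = k * (norm (m - n))\<^sup>2 / 2"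
proof -
  define c where "c = n \<bullet> m"
  have nn: "n \<bullet> n = 1" "m \<bullet> m = 1" using n m by (auto simp: norm_eq_1)
  have dist: "(norm (m - n))\<^sup>2 = 2 * (1 - c)"
    by (simp add: power2_norm_eq_inner algebra_simps inner_commute nn c_def)
  have "(norm (m + n))\<^sup>2 = 2 * (1 + c)"
    by (simp add: power2_norm_eq_inner algebra_simps inner_commute nn c_def)
  moreover have "m + n \<noteq> 0" using assms(4) by (metis add_eq_0_iff)
  ultimately have c: "1 + c \<noteq> 0" by (metis mult_zero_right norm_eq_zero power_eq_0_iff)
  have c': "1 - c \<noteq> 0" using dist assms(3) by auto
  have X2: "(norm (cross3 n m))\<^sup>2 = (1 + c) * (1 - c)"
    by (simp add: norm_cross n m flip: c_def) (simp add: algebra_simps power2_eq_square)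
  show ?thesis
  proof (cases "d = 0")
    case True
    then have "k = 0" using d X2 c c' by auto
    then show ?thesis using True by simp
  next
    case False
    define s where "s = cross3 n m \<bullet> ((1 / norm d) *\<^sub>R d)"
    have s: "s * norm d = k * ((1 + c) * (1 - c))"
      unfolding s_def using False X2 by (simp add: d power2_norm_eq_inner)
    have nd: "(norm d)\<^sup>2 = k\<^sup>2 * ((1 + c) * (1 - c))" using X2 by (simp add: d power_mult_distrib)
    have k: "k \<noteq> 0" using False d by auto
    have "s\<^sup>2 * (norm d)\<^sup>2 = (k * ((1 + c) * (1 - c)))\<^sup>2" using s by (metis power_mult_distrib)
    then have "(k\<^sup>2 * ((1 + c) * (1 - c))) * s\<^sup>2 = (k\<^sup>2 * ((1 + c) * (1 - c))) * ((1 + c) * (1 - c))"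
      unfolding nd by (simp add: power2_eq_square mult_ac)
    then have "s\<^sup>2 = (1 + c) * (1 - c)" using k c c' by simp
    then have "s\<^sup>2 + c\<^sup>2 = 1" by (simp add: algebra_simps power2_eq_square)
    from tan_half_angle[OF this] c
    have "tan ((THE \<alpha>. - pi < \<alpha> \<and> \<alpha> < pi \<and> sin \<alpha> = s \<and> cos \<alpha> = c) / 2) = s / (1 + c)" by auto
    moreover have "norm d * (s / (1 + c)) = k * (1 - c)" using s c by (simp add: field_simps)
    ultimately show ?thesis using False dist by (simp add: s_def c_def)
  qed
qed

text \<open>
  Expanding around \<open>z\<close> separates the two sums in the definition of a holomorphic quadratic
  differential: \<open>z\<close> is the vertex of the star and only the coefficients depend on the neighbour \<open>w\<close>.
\<close>

lemma weierstrass_vec_eq: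
  assumes "z \<noteq> w"
  shows "weierstrass_vec z w q =
    (of_real q / (w - z)) *s vector [1 - z\<^sup>2, \<i> * (1 + z\<^sup>2), 2 * z] + of_real q *s vector [- z, \<i> * z, 1]"
  using assms by (simp add: weierstrass_vec_def vec_eq_iff forall_3 divide_simps)
    (simp add: algebra_simps power2_eq_square)

lemma weierstrass_vec_flip: "weierstrass_vec w z q = - weierstrass_vec z w q"
proof -
  have "of_real q / (z - w) = - (of_real q / (w - z))"
    by (metis minus_diff_eq minus_divide_right)
  then show ?thesis
    by (simp add: weierstrass_vec_def vec_eq_iff forall_3 algebra_simps)
qed

text \<open>
  A complex vector \<open>x\<close> is recovered from \<open>Re x\<close> and \<open>Re (\<i> x) = - Im x\<close>; this is why a conjugate pair is
  assembled as \<open>f - \<i> f'\<close>.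
\<close>

lemma complex_vec_Re_vec:
  "complex_vec (Re_vec x) - \<i> *s complex_vec (Re_vec (\<i> *s x)) = x"
  by (simp add: vec_eq_iff complex_vec_def Re_vec_def complex_eq_iff)

lemma dual_diff_Re_vec: "dual_diff M (\<lambda>\<phi>. Re_vec (F \<phi>)) e = Re_vec (dual_diff M F e)"
  by (simp add: dual_diff_def Re_vec_def vec_eq_iff)

lemma dual_diff_scale:
  fixes c :: complex
  shows "dual_diff M (\<lambda>\<phi>. c *s F \<phi>) e = c *s dual_diff M F e"
  by (simp add: dual_diff_def vec_eq_iff right_diff_distrib)

lemma dual_diff_complex_vec:
  "dual_diff M (\<lambda>\<phi>. complex_vec (f \<phi>) - \<i> *s complex_vec (g \<phi>)) e =
    complex_vec (dual_diff M f e) - \<i> *s complex_vec (dual_diff M g e)"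
  by (simp add: dual_diff_def complex_vec_def vec_eq_iff algebra_simps)

lemma inv_stereo_inj: "z \<noteq> w \<Longrightarrow> inv_stereo z \<noteq> inv_stereo w"
proof
  assume "z \<noteq> w" "inv_stereo z = inv_stereo w"
  moreover have "1 + (cmod z)\<^sup>2 \<noteq> 0" "1 + (cmod w)\<^sup>2 \<noteq> 0" by (auto simp: add_nonneg_eq_0_iff)
  ultimately show False using norm_inv_stereo_diff[of w z] by simp
qed

lemma weierstrass_rep_iff:
  "weierstrass_rep M z q \<F> \<longleftrightarrow> (\<forall>e\<in>int_oedges M.
    dual_diff M \<F> e = weierstrass_vec (z (src M e)) (z (tgt M e)) (q (edge M e)))"
  by (simp add: weierstrass_rep_def weierstrass_vec_def)

section \<open>Weierstrass representation of conjugate pairs\<close>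

context discrete_surface
begin

lemma sum_weierstrass_vec:
  assumes "nondegenerate M z" "i \<in> verts M"
  shows "(\<Sum>e\<in>star M i. weierstrass_vec (z (src M e)) (z (tgt M e)) (q (edge M e))) =
    (\<Sum>e\<in>star M i. of_real (q (edge M e)) / (z (tgt M e) - z i)) *s
      vector [1 - (z i)\<^sup>2, \<i> * (1 + (z i)\<^sup>2), 2 * z i] +
    of_real (\<Sum>e\<in>star M i. q (edge M e)) *s vector [- z i, \<i> * z i, 1]"
proof -
  have "weierstrass_vec (z (src M e)) (z (tgt M e)) (q (edge M e)) =
      (of_real (q (edge M e)) / (z (tgt M e) - z i)) *s
        vector [1 - (z i)\<^sup>2, \<i> * (1 + (z i)\<^sup>2), 2 * z i] +
      of_real (q (edge M e)) *s vector [- z i, \<i> * z i, 1]" if "e \<in> star M i" for e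
    using assms that weierstrass_vec_eq[of "z i" "z (tgt M e)"]
    by (auto simp: star_def nondegenerate_def)
  then show ?thesis
    by (simp add: sum.distrib vec.scale_sum_left)
qed

lemma weierstrass_primitive_exists:
  assumes sc: "simply_connected_surface M"
    and z: "nondegenerate M z" and q: "hol_quad_diff M z q"
  shows "\<exists>\<F>. weierstrass_rep M z q \<F>"
  unfolding weierstrass_rep_iff
proof (rule closed_dual_form_exact[OF sc])
  fix e assume "e \<in> int_oedges M"
  then show "weierstrass_vec (z (src M (opp M e))) (z (tgt M (opp M e))) (q (edge M (opp M e))) =
      - weierstrass_vec (z (src M e)) (z (tgt M e)) (q (edge M e))"
    using weierstrass_vec_flip[of "z (tgt M e)" "z (src M e)"] by (simp add: src_opp tgt_opp edge_opp int_in)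
next
  fix i assume "i \<in> int_verts M"
  with q sum_weierstrass_vec[OF z, of i q]
  show "(\<Sum>e\<in>star M i. weierstrass_vec (z (src M e)) (z (tgt M e)) (q (edge M e))) = 0"
    by (simp add: hol_quad_diff_def int_verts_def del: of_real_sum)
qed

text \<open>
  Both directions read this formula: with \<open>k\<close> computed from \<open>q\<close>, or with \<open>q\<close> computed from \<open>k\<close>, the
  summand is \<open>q\<close>.
\<close>

lemma mean_curvature_eq:
  assumes N: "admissible M N"
    and f: "\<And>e. e \<in> star M i \<Longrightarrow> N (src M e) \<noteq> N (tgt M e)"
      "\<And>e. e \<in> star M i \<Longrightarrow> dual_diff M f e = k e *\<^sub>R cross3 (N (src M e)) (N (tgt M e))"
  shows "mean_curvature M N f i = (\<Sum>e\<in>star M i. k e * (norm (primal_diff M N e))\<^sup>2 / 2)"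
  unfolding mean_curvature_def dihedral_angle_def primal_diff_def
proof (rule sum.cong[OF refl])
  fix e assume e: "e \<in> star M i"
  then have "e \<in> oedges M" by (simp add: star_def)
  with N e show "(if dual_diff M f e = 0 then 0
      else norm (dual_diff M f e) * tan ((THE \<alpha>. - pi < \<alpha> \<and> \<alpha> < pi \<and>
        sin \<alpha> = cross3 (N (src M e)) (N (tgt M e)) \<bullet>
          ((1 / norm (dual_diff M f e)) *\<^sub>R dual_diff M f e) \<and>
        cos \<alpha> = N (src M e) \<bullet> N (tgt M e)) / 2)) = k e * (norm (N (tgt M e) - N (src M e)))\<^sup>2 / 2"
    by (intro norm_mult_tan_dihedral f) (auto simp: admissible_def src_in tgt_in)
qed

lemma weierstrass_conjugate_pair:
  assumes z: "nondegenerate M z" and q: "hol_quad_diff M z q"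
    and N_def: "N = (\<lambda>i. inv_stereo (z i))" and N: "admissible M N"
    and \<F>: "weierstrass_rep M z q \<F>"
  shows "conjugate_pair M N (\<lambda>\<phi>. Re_vec (\<F> \<phi>)) (\<lambda>\<phi>. Re_vec (\<i> *s \<F> \<phi>))"
proof -
  let ?f = "\<lambda>\<phi>. Re_vec (\<F> \<phi>)" and ?f' = "\<lambda>\<phi>. Re_vec (\<i> *s \<F> \<phi>)"
  define k where "k e = 2 * q (edge M e) / (norm (primal_diff M N e))\<^sup>2" for e
  have neq: "N (src M e) \<noteq> N (tgt M e)" if "e \<in> oedges M" for e
    using z that inv_stereo_inj by (auto simp: nondegenerate_def N_def)
  have f: "dual_diff M ?f e = k e *\<^sub>R (N (tgt M e) - N (src M e))"
      "dual_diff M ?f' e = k e *\<^sub>R cross3 (N (src M e)) (N (tgt M e))" if e: "e \<in> int_oedges M" for e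
    using \<F> z e Re_weierstrass_vec[of "z (src M e)" "z (tgt M e)" "q (edge M e)"]
    by (simp_all add: dual_diff_Re_vec dual_diff_scale weierstrass_rep_iff nondegenerate_def int_in
        k_def primal_diff_def N_def)
  have unit: "N (src M e) \<bullet> N (src M e) = 1" "N (tgt M e) \<bullet> N (tgt M e) = 1"
    if "e \<in> int_oedges M" for e
    using N that by (simp_all add: admissible_def src_in tgt_in int_in flip: norm_eq_1)
  then have orth: "(N (src M e) + N (tgt M e)) \<bullet> (N (tgt M e) - N (src M e)) = 0"
    if "e \<in> int_oedges M" for e
    using that by (simp add: inner_diff_left inner_diff_right inner_add_left inner_add_right
        inner_commute)
  have "A_minimal M N ?f"
    using N orth by (simp add: A_minimal_def f primal_diff_def cross_mult_right cross_refl inner_commute)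
  moreover have "mean_curvature M N ?f' i = 0" if i: "i \<in> int_verts M" for i
  proof -
    have star: "e \<in> int_oedges M" if "e \<in> star M i" for e
      using i that by (auto simp: int_verts_def)
    have "mean_curvature M N ?f' i = (\<Sum>e\<in>star M i. k e * (norm (primal_diff M N e))\<^sup>2 / 2)"
      using star f(2) neq int_in by (intro mean_curvature_eq N) blast+
    also have "\<dots> = (\<Sum>e\<in>star M i. q (edge M e))"
      using neq[THEN not_sym] star by (intro sum.cong refl) (auto simp: k_def primal_diff_def int_in)
    finally show ?thesis using q i by (simp add: hol_quad_diff_def)
  qed
  then have "C_minimal M N ?f'"
    using N by (simp add: C_minimal_def f dot_cross_self)
  ultimately show ?thesis
    by (simp add: conjugate_pair_def f cross_mult_right Cross3.right_diff_distrib cross_refl)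
      (metis cross_skew scaleR_minus_right)
qed

text \<open>
  As \<open>dN \<times> df = 0\<close>, the dual edge \<open>df\<close> is a multiple \<open>k dN\<close>, and \<open>q = k \<bar>dN\<bar>\<^sup>2 / 2 = dN \<bullet> df / 2\<close>
  is forced by the formula for \<open>Re W\<close>.  The first sum is then the mean curvature of \<open>f'\<close>, and the
  second one follows from the first and the exactness of \<open>W\<close>.
\<close>

lemma conjugate_pair_weierstrass:
  assumes pair: "conjugate_pair M N f f'" and z_def: "z = (\<lambda>i. stereo (N i))"
    and pole: "\<forall>i\<in>verts M. N i $ 3 \<noteq> 1" and z: "nondegenerate M z"
  shows "\<exists>q. hol_quad_diff M z q \<and>
    weierstrass_rep M z q (\<lambda>\<phi>. complex_vec (f \<phi>) - \<i> *s complex_vec (f' \<phi>))"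
proof -
  let ?F = "\<lambda>\<phi>. complex_vec (f \<phi>) - \<i> *s complex_vec (f' \<phi>)"
  have N: "admissible M N" and C: "C_minimal M N f'"
    using pair by (auto simp: conjugate_pair_def C_minimal_def)
  have N_inv: "inv_stereo (z i) = N i" if "i \<in> verts M" for i
    using N pole that by (simp add: z_def admissible_def inv_stereo_stereo)
  have neq: "N (src M e) \<noteq> N (tgt M e)" if "e \<in> oedges M" for e
    using z that by (auto simp: nondegenerate_def z_def)
  define p where "p e = primal_diff M N e \<bullet> dual_diff M f e / 2" for e
  define q where "q E = p (SOME e. e \<in> E)" for E
  \<comment> \<open>Reversing the edge changes the sign of both factors, so \<open>p\<close> descends to unoriented edges.\<close>
  have "p (opp M e) = p e" if "e \<in> oedges M" for e
    using that by (simp add: p_def primal_diff_def dual_diff_def src_opp tgt_opp opp_opp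
        inner_diff_left inner_diff_right)
  then have q: "q (edge M e) = p e" if "e \<in> oedges M" for e
    using that someI[of "\<lambda>x. x \<in> edge M e" e] by (auto simp: q_def edge_def)
  define k where "k e = 2 * q (edge M e) / (norm (primal_diff M N e))\<^sup>2" for e
  have k: "q (edge M e) = k e * (norm (primal_diff M N e))\<^sup>2 / 2" if "e \<in> oedges M" for e
    using neq[OF that] by (simp add: k_def primal_diff_def)
  have f: "dual_diff M f e = k e *\<^sub>R primal_diff M N e"
      "dual_diff M f' e = k e *\<^sub>R cross3 (N (src M e)) (N (tgt M e))" if e: "e \<in> int_oedges M" for e
  proof -
    have d: "primal_diff M N e \<noteq> 0" using neq[of e] e by (auto simp: primal_diff_def int_in)
    have "cross3 (primal_diff M N e) (dual_diff M f e) = 0"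
      using pair e by (simp add: conjugate_pair_def A_minimal_def)
    then obtain c where c: "dual_diff M f e = c *\<^sub>R primal_diff M N e"
      using d unfolding cross_eq_0 collinear_lemma by (metis scaleR_zero_left)
    then have "q (edge M e) = c * (norm (primal_diff M N e))\<^sup>2 / 2"
      using e by (simp add: q p_def int_in power2_norm_eq_inner)
    then have "k e = c" using d by (simp add: k_def field_simps)
    with c show 1: "dual_diff M f e = k e *\<^sub>R primal_diff M N e" by simp
    have "dual_diff M f' e = cross3 (N (src M e)) (dual_diff M f e)"
      using pair e by (simp add: conjugate_pair_def)
    then show "dual_diff M f' e = k e *\<^sub>R cross3 (N (src M e)) (N (tgt M e))"
      by (simp add: 1 primal_diff_def cross_mult_right Cross3.right_diff_distrib)
  qed
  have rep: "dual_diff M ?F e = weierstrass_vec (z (src M e)) (z (tgt M e)) (q (edge M e))"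
    if e: "e \<in> int_oedges M" for e
  proof -
    let ?W = "weierstrass_vec (z (src M e)) (z (tgt M e)) (q (edge M e))"
    have "Re_vec ?W = dual_diff M f e" "Re_vec (\<i> *s ?W) = dual_diff M f' e"
      using z e Re_weierstrass_vec[of "z (src M e)" "z (tgt M e)" "q (edge M e)"] f[OF e]
      by (simp_all add: nondegenerate_def int_in N_inv src_in tgt_in k_def primal_diff_def)
    then show ?thesis using complex_vec_Re_vec[of ?W] by (simp add: dual_diff_complex_vec)
  qed
  have "(\<Sum>e\<in>star M i. q (edge M e)) = 0 \<and>
      (\<Sum>e\<in>star M i. of_real (q (edge M e)) / (z (tgt M e) - z i)) = 0"
    if i: "i \<in> int_verts M" for i
  proof
    have star: "e \<in> int_oedges M" if "e \<in> star M i" for e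
      using i that by (auto simp: int_verts_def)
    have "(\<Sum>e\<in>star M i. q (edge M e)) = (\<Sum>e\<in>star M i. k e * (norm (primal_diff M N e))\<^sup>2 / 2)"
      using star k int_in by (intro sum.cong) auto
    also have "\<dots> = mean_curvature M N f' i"
      using star f(2) neq int_in by (intro mean_curvature_eq[symmetric] N) blast+
    finally show q0: "(\<Sum>e\<in>star M i. q (edge M e)) = 0"
      using C i by (simp add: C_minimal_def)
    have "(\<Sum>e\<in>star M i. weierstrass_vec (z (src M e)) (z (tgt M e)) (q (edge M e))) = 0"
      using sum_dual_diff_star[OF i, of ?F] star rep by simp
    then have "(\<Sum>e\<in>star M i. of_real (q (edge M e)) / (z (tgt M e) - z i)) *s
        vector [1 - (z i)\<^sup>2, \<i> * (1 + (z i)\<^sup>2), 2 * z i] = (0 :: complex^3)"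
      using sum_weierstrass_vec[OF z, of i q] i q0 by (simp add: int_verts_def del: of_real_sum)
    \<comment> \<open>The numbers \<open>1 - (z i)\<^sup>2\<close> and \<open>1 + (z i)\<^sup>2\<close> cannot vanish together.\<close>
    moreover have "vector [1 - (z i)\<^sup>2, \<i> * (1 + (z i)\<^sup>2), 2 * z i] \<noteq> (0 :: complex^3)"
      by (auto simp: vec_eq_iff forall_3)
    ultimately show "(\<Sum>e\<in>star M i. of_real (q (edge M e)) / (z (tgt M e) - z i)) = 0"
      by (simp only: vec.scale_eq_0_iff) blast
  qed
  then have "hol_quad_diff M z q" by (simp add: hol_quad_diff_def)
  with rep show ?thesis by (auto simp: weierstrass_rep_iff)
qed

end

theorem theorem5p0p1:
  fixes M :: "('v, 'e, 'f) cell_decomp"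
  assumes "discrete_surface M" and "simply_connected_surface M"
  shows
    "(\<forall>(z :: 'v \<Rightarrow> complex) (q :: 'e set \<Rightarrow> real).
        nondegenerate M z \<and> hol_quad_diff M z q \<longrightarrow>
        (\<exists>\<F> :: 'f \<Rightarrow> complex^3. weierstrass_rep M z q \<F>) \<and>
        (let N = (\<lambda>i. inv_stereo (z i)) in
          admissible M N \<longrightarrow>
          (\<forall>\<F> :: 'f \<Rightarrow> complex^3. weierstrass_rep M z q \<F> \<longrightarrow>
            (let f = (\<lambda>\<phi>. Re_vec (\<F> \<phi>)); f' = (\<lambda>\<phi>. Re_vec (\<i> *s \<F> \<phi>)) in
              A_minimal M N f \<and> C_minimal M N f' \<and> conjugate_pair M N f f')))) \<and>
     (\<forall>(N :: 'v \<Rightarrow> real^3) (f :: 'f \<Rightarrow> real^3) (f' :: 'f \<Rightarrow> real^3).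
        let z = (\<lambda>i. stereo (N i)) in
          conjugate_pair M N f f' \<and> (\<forall>i\<in>verts M. N i $ 3 \<noteq> 1) \<and> nondegenerate M z \<longrightarrow>
          (\<exists>q :: 'e set \<Rightarrow> real. hol_quad_diff M z q \<and>
            weierstrass_rep M z q (\<lambda>\<phi>. complex_vec (f \<phi>) - \<i> *s complex_vec (f' \<phi>))))"
proof -
  interpret discrete_surface M by fact
  have pair: "conjugate_pair M (\<lambda>i. inv_stereo (z i)) (\<lambda>\<phi>. Re_vec (\<F> \<phi>)) (\<lambda>\<phi>. Re_vec (\<i> *s \<F> \<phi>))"
    if "nondegenerate M z" "hol_quad_diff M z q" "admissible M (\<lambda>i. inv_stereo (z i))"
      "weierstrass_rep M z q \<F>" for z q and \<F> :: "'f \<Rightarrow> complex^3"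
    using weierstrass_conjugate_pair that by blast
  then have "A_minimal M (\<lambda>i. inv_stereo (z i)) (\<lambda>\<phi>. Re_vec (\<F> \<phi>))"
      "C_minimal M (\<lambda>i. inv_stereo (z i)) (\<lambda>\<phi>. Re_vec (\<i> *s \<F> \<phi>))"
    if "nondegenerate M z" "hol_quad_diff M z q" "admissible M (\<lambda>i. inv_stereo (z i))"
      "weierstrass_rep M z q \<F>" for z q and \<F> :: "'f \<Rightarrow> complex^3"
    using that by (auto simp: conjugate_pair_def)
  with pair show ?thesis
    unfolding Let_def
    using weierstrass_primitive_exists[OF assms(2)] conjugate_pair_weierstrass by blast
qed

end
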